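(* Let $k\geq 2$ and $n\geq 2k-3$ be integers. Then any polynomial $P\in \mathbb{R}[x_1,\dots,x_n]$ with $P(0,\dots,0)\neq 0$ having zeroes of multiplicity at least $k$ at all points in $\{0,1\}^n\setminus \{(0,\dots,0)\}$ has degree $\deg P\geq n+2k-3$. Furthermore, there exists such a polynomial $P$ with degree $\deg P= n+2k-3$.
   Context: A polynomial $P\in \mathbb{R}[x_1,\dots,x_n]$ has a zero of multiplicity at least $k$ at a point $a\in \mathbb{R}^n$ if all partial derivatives of $P$ of order at most $k-1$ (including $P$ itself) vanish at $a$. *)

theory Defs
  imports "HOL-Analysis.Analysis" "HOL-Library.Poly_Mapping" "HOL-Library.FuncSet"
begin

text \<open>
  A real polynomial is a finitely supported map from monomials to coefficients, where a monomial
  is a finitely supported map from (indices of) variables to exponents. The ring structure is that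
  of the monoid algebra in \<^theory>\<open>HOL-Library.Poly_Mapping\<close>. The ring of polynomials in the
  variables with indices \<open>1, \<dots>, n\<close> is the carrier set \<open>polys n\<close>.
\<close>

type_synonym monomial = "nat \<Rightarrow>\<^sub>0 nat"
type_synonym real_mpoly = "monomial \<Rightarrow>\<^sub>0 real"

definition polys :: "nat \<Rightarrow> real_mpoly set" where
  "polys n = {P. \<forall>m \<in> Poly_Mapping.keys P. Poly_Mapping.keys m \<subseteq> {1..n}}"

definition eval_mpoly :: "real_mpoly \<Rightarrow> (nat \<Rightarrow> real) \<Rightarrow> real" where
  "eval_mpoly P a = (\<Sum>m \<in> Poly_Mapping.keys P. Poly_Mapping.lookup P m *
     (\<Prod>i \<in> Poly_Mapping.keys m. a i ^ Poly_Mapping.lookup m i))"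

text \<open>The zero polynomial gets total degree \<open>0\<close>.\<close>

definition total_degree :: "real_mpoly \<Rightarrow> nat" where
  "total_degree P = Max (insert 0
     ((\<lambda>m. \<Sum>i \<in> Poly_Mapping.keys m. Poly_Mapping.lookup m i) ` Poly_Mapping.keys P))"

text \<open>
  Subtraction of exponents is truncated, but if the variable \<open>i\<close> does not occur in \<open>m\<close> then the
  coefficient of the corresponding summand is \<open>0\<close>.
\<close>

definition partial_deriv :: "nat \<Rightarrow> real_mpoly \<Rightarrow> real_mpoly" where
  "partial_deriv i P = (\<Sum>m \<in> Poly_Mapping.keys P.
     Poly_Mapping.single (m - Poly_Mapping.single i 1)
       (real (Poly_Mapping.lookup m i) * Poly_Mapping.lookup P m))"

text \<open>
  A partial derivative of order \<open>r\<close> is given by a list of \<open>r\<close> variable indices. For \<open>k \<ge> 1\<close> the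
  condition \<open>length is < k\<close> says that the order is at most \<open>k - 1\<close>.
\<close>

definition has_zero_of_mult_ge :: "nat \<Rightarrow> nat \<Rightarrow> real_mpoly \<Rightarrow> (nat \<Rightarrow> real) \<Rightarrow> bool" where
  "has_zero_of_mult_ge n k P a \<longleftrightarrow>
     (\<forall>is. set is \<subseteq> {1..n} \<and> length is < k \<longrightarrow> eval_mpoly (foldr partial_deriv is P) a = 0)"

text \<open>
  Points of \<open>n\<close>-dimensional space are functions on \<open>{1..n}\<close>, extended by \<open>undefined\<close>; polynomials
  in \<open>polys n\<close> do not depend on the values outside \<open>{1..n}\<close>.
\<close>

definition cube :: "nat \<Rightarrow> (nat \<Rightarrow> real) set" where
  "cube n = {1..n} \<rightarrow>\<^sub>E {0, 1}"

definition origin :: "nat \<Rightarrow> nat \<Rightarrow> real" where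
  "origin n = (\<lambda>i\<in>{1..n}. 0)"

end

theory Submission
  imports Defs
begin

text \<open>
  Put \<open>y_i = x_i (x_i - 1)\<close>, which is a local parameter at both \<open>x_i = 0\<close> and \<open>x_i = 1\<close>.

  Lower bound. For a multi-index \<open>\<alpha>\<close> consider the iterated residue of \<open>Q / \<Prod>y_i^(\<alpha>_i + 1)\<close>. Its
  residues at the points of the cube sum to \<open>0\<close> if \<open>deg Q < n + 2|\<alpha>|\<close>, and the residue at a zero of
  multiplicity greater than \<open>|\<alpha>|\<close> vanishes. If \<open>deg P < n + 2 k - 3\<close>, this applies with
  \<open>|\<alpha>| = k - 1\<close> to \<open>Q = P\<close> and to \<open>Q = x_i P\<close>, so the residues of both at the origin vanish. Near the
  origin \<open>x_i\<close> is a power series in \<open>y_i\<close> all of whose coefficients except the constant one are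
  nonzero (Catalan numbers). Hence, if \<open>\<beta>_i = 0\<close>, then the residue of \<open>x_i P\<close> for
  \<open>\<alpha> = \<beta> + b e_i\<close> is a nonzero multiple of the residue of \<open>P\<close> for \<open>\<beta>\<close> plus a combination of
  residues for larger indices. Descending on \<open>|\<beta>|\<close> down to \<open>\<beta> = 0\<close> gives \<open>P(0) = 0\<close>.

  Construction. Let \<open>t\<close> be a polynomial of degree less than \<open>k\<close> with \<open>t(0) = 1\<close> such that
  \<open>t(y_i) + 1 - 2 x_i\<close> is divisible by \<open>(x_i - 1)^k\<close> (a truncation of the square root of \<open>1 + 4 y\<close>).
  The product of these factors over all \<open>i\<close> has all the required zeroes; discarding the terms of degree
  at least \<open>k\<close> in the \<open>y_i\<close> changes neither this nor the value at the origin, and what remains has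
  degree at most \<open>n + 2 k - 3\<close>.
\<close>

subsection \<open>Polynomials as linear combinations of monomials\<close>

abbreviation keys where "keys \<equiv> Poly_Mapping.keys"
abbreviation lookup where "lookup \<equiv> Poly_Mapping.lookup"
abbreviation single where "single \<equiv> Poly_Mapping.single"

lemma poly_mapping_add_induct [case_names zero single add]:
  fixes f :: "'a \<Rightarrow>\<^sub>0 'b::monoid_add"
  assumes zero: "Q 0" and single: "\<And>m c. Q (single m c)"
    and add: "\<And>f g. Q f \<Longrightarrow> Q g \<Longrightarrow> Q (f + g)"
  shows "Q f"
proof (induction f rule: update_induct)
  case const
  show ?case by (rule zero)
next
  case (update f a b)
  have "Poly_Mapping.update a b f = f + single a b"
    using update.hyps
    by (intro poly_mapping_eqI) (auto simp: lookup_update lookup_add lookup_single in_keys_iff when_def)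
  then show ?case
    using add[OF update.IH single] by simp
qed

text \<open>Evaluation, derivatives at a point and residues are all linear functionals given by
  their values on monomials; in this common form linearity is proved once.\<close>

definition lin :: "(monomial \<Rightarrow> real) \<Rightarrow> real_mpoly \<Rightarrow> real" where
  "lin \<phi> P = (\<Sum>m\<in>keys P. lookup P m * \<phi> m)"

lemma lin_superset:
  "finite A \<Longrightarrow> keys P \<subseteq> A \<Longrightarrow> lin \<phi> P = (\<Sum>m\<in>A. lookup P m * \<phi> m)"
  unfolding lin_def by (intro sum.mono_neutral_left) (auto simp: in_keys_iff)

lemma lin_zero [simp]: "lin \<phi> 0 = 0"
  by (simp add: lin_def)

lemma lin_single [simp]: "lin \<phi> (single m c) = c * \<phi> m"
  by (simp add: lin_def)

lemma lin_add [simp]: "lin \<phi> (P + Q) = lin \<phi> P + lin \<phi> Q"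
proof -
  have "keys (P + Q) \<subseteq> keys P \<union> keys Q" by (rule keys_add)
  then show ?thesis
    by (simp add: lin_superset[of "keys P \<union> keys Q"] lookup_add distrib_right sum.distrib)
qed

lemma lin_minus [simp]: "lin \<phi> (- P) = - lin \<phi> P"
  using lin_add[of \<phi> P "- P"] by simp

lemma lin_diff [simp]: "lin \<phi> (P - Q) = lin \<phi> P - lin \<phi> Q"
  using lin_add[of \<phi> P "- Q"] by simp

lemma lin_sum [simp]: "lin \<phi> (sum f A) = (\<Sum>x\<in>A. lin \<phi> (f x))"
  by (induction A rule: infinite_finite_induct) auto

lemma lin_fun_sum: "lin (\<lambda>m. \<Sum>x\<in>A. \<phi> x m) P = (\<Sum>x\<in>A. lin (\<phi> x) P)"
  unfolding lin_def by (subst sum.swap) (simp add: sum_distrib_left)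

lemma lin_fun_scale: "lin (\<lambda>m. c * \<phi> m) P = c * lin \<phi> P"
  by (simp add: lin_def sum_distrib_left algebra_simps)

lemma lin_cong: "(\<And>m. m \<in> keys P \<Longrightarrow> \<phi> m = \<psi> m) \<Longrightarrow> lin \<phi> P = lin \<psi> P"
  by (simp add: lin_def)

lemma lin_mult_single: "lin \<phi> (single d 1 * P) = lin (\<lambda>m. \<phi> (d + m)) P"
  by (induction P rule: poly_mapping_add_induct) (auto simp: mult_single distrib_left)

section \<open>Evaluation\<close>

lemma eval_mpoly_lin: "eval_mpoly P a = lin (\<lambda>m. \<Prod>i\<in>keys m. a i ^ lookup m i) P"
  by (simp add: eval_mpoly_def lin_def)

lemma eval_mpoly_zero [simp]: "eval_mpoly 0 a = 0"
  and eval_mpoly_add [simp]: "eval_mpoly (P + Q) a = eval_mpoly P a + eval_mpoly Q a"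
  and eval_mpoly_minus [simp]: "eval_mpoly (- P) a = - eval_mpoly P a"
  and eval_mpoly_diff [simp]: "eval_mpoly (P - Q) a = eval_mpoly P a - eval_mpoly Q a"
  and eval_mpoly_sum [simp]: "eval_mpoly (sum f A) a = (\<Sum>x\<in>A. eval_mpoly (f x) a)"
  by (simp_all add: eval_mpoly_lin)

lemma prod_keys_superset:
  fixes a :: "nat \<Rightarrow> real"
  shows "finite A \<Longrightarrow> keys m \<subseteq> A \<Longrightarrow> (\<Prod>i\<in>keys m. a i ^ lookup m i) = (\<Prod>i\<in>A. a i ^ lookup m i)"
  by (intro prod.mono_neutral_left) (auto simp: in_keys_iff)

lemma eval_mpoly_mult [simp]: "eval_mpoly (P * Q) a = eval_mpoly P a * eval_mpoly Q a"
proof (induction P rule: poly_mapping_add_induct)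
  case (single m c)
  show ?case
  proof (induction Q rule: poly_mapping_add_induct)
    case (single m' c')
    have "keys (m + m') \<subseteq> keys m \<union> keys m'" by (rule keys_add)
    then have "(\<Prod>i\<in>keys (m + m'). a i ^ lookup (m + m') i) =
        (\<Prod>i\<in>keys m \<union> keys m'. a i ^ lookup (m + m') i)"
      by (intro prod_keys_superset) auto
    also have "\<dots> = (\<Prod>i\<in>keys m \<union> keys m'. a i ^ lookup m i) *
        (\<Prod>i\<in>keys m \<union> keys m'. a i ^ lookup m' i)"
      by (simp add: lookup_add power_add prod.distrib)
    finally show ?case
      by (simp add: mult_single eval_mpoly_lin prod_keys_superset[of "keys m \<union> keys m'" m]
          prod_keys_superset[of "keys m \<union> keys m'" m'])
  qed (auto simp: distrib_left)
qed (auto simp: distrib_right)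

lemma eval_mpoly_one [simp]: "eval_mpoly 1 a = 1"
  by (simp add: eval_mpoly_def)

lemma eval_mpoly_power [simp]: "eval_mpoly (P ^ j) a = eval_mpoly P a ^ j"
  by (induction j) auto

lemma eval_mpoly_prod [simp]: "eval_mpoly (prod f A) a = (\<Prod>x\<in>A. eval_mpoly (f x) a)"
  by (induction A rule: infinite_finite_induct) auto

definition Var :: "nat \<Rightarrow> real_mpoly" where
  "Var i = single (single i 1) 1"

abbreviation Const :: "real \<Rightarrow> real_mpoly" where "Const c \<equiv> single 0 c"

lemma eval_mpoly_Var [simp]: "eval_mpoly (Var i) a = a i"
  and eval_mpoly_Const [simp]: "eval_mpoly (Const c) a = c"
  by (simp_all add: Var_def eval_mpoly_lin)

section \<open>Partial derivatives\<close>

lemma partial_deriv_superset: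
  "finite A \<Longrightarrow> keys P \<subseteq> A \<Longrightarrow>
     partial_deriv i P = (\<Sum>m\<in>A. single (m - single i 1) (real (lookup m i) * lookup P m))"
  unfolding partial_deriv_def by (intro sum.mono_neutral_left) (auto simp: in_keys_iff)

lemma partial_deriv_zero [simp]: "partial_deriv i 0 = 0"
  by (simp add: partial_deriv_def)

lemma partial_deriv_single [simp]:
  "partial_deriv i (single m c) = single (m - single i 1) (real (lookup m i) * c)"
  by (simp add: partial_deriv_def)

lemma partial_deriv_add [simp]: "partial_deriv i (P + Q) = partial_deriv i P + partial_deriv i Q"
proof -
  have "keys (P + Q) \<subseteq> keys P \<union> keys Q" by (rule keys_add)
  then show ?thesis
    by (simp add: partial_deriv_superset[of "keys P \<union> keys Q"] lookup_add distrib_left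
        single_add sum.distrib)
qed

lemma partial_deriv_minus [simp]: "partial_deriv i (- P) = - partial_deriv i P"
  using partial_deriv_add[of i P "- P"] by (metis add.right_inverse add_eq_0_iff partial_deriv_zero)

lemma single_diff_add:
  fixes m m' :: monomial
  assumes "lookup m i > 0"
  shows "m - single i 1 + m' = m + m' - single i 1"
  using assms by (intro poly_mapping_eqI) (auto simp: lookup_add lookup_minus lookup_single when_def)

lemma partial_deriv_mult [simp]:
  "partial_deriv i (P * Q) = partial_deriv i P * Q + P * partial_deriv i Q"
proof (induction P rule: poly_mapping_add_induct)
  case (single m c)
  show ?case
  proof (induction Q rule: poly_mapping_add_induct)
    case (single m' c')
    \<comment> \<open>If \<open>i\<close> does not occur in \<open>m\<close>, the exponents may
      differ because subtraction is truncated, but then the coefficient is \<open>0\<close>.\<close>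
    have 1: "single (m - single i 1 + m') (real (lookup m i) * (c * c')) =
        single (m + m' - single i 1) (real (lookup m i) * (c * c'))"
      using single_diff_add[of m i m'] by (cases "lookup m i = 0") auto
    have 2: "single (m + (m' - single i 1)) (real (lookup m' i) * (c * c')) =
        single (m + m' - single i 1) (real (lookup m' i) * (c * c'))"
      using single_diff_add[of m' i m] by (cases "lookup m' i = 0") (auto simp: add.commute)
    have "partial_deriv i (single m c * single m' c') =
        single (m + m' - single i 1) (real (lookup m i) * (c * c') + real (lookup m' i) * (c * c'))"
      by (simp add: mult_single lookup_add distrib_right)
    also have "\<dots> = single (m - single i 1 + m') (real (lookup m i) * (c * c')) +
        single (m + (m' - single i 1)) (real (lookup m' i) * (c * c'))"
      by (simp only: single_add 1 2)
    also have "\<dots> = partial_deriv i (single m c) * single m' c' +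
        single m c * partial_deriv i (single m' c')"
      by (simp add: mult_single ac_simps)
    finally show ?case .
  qed (auto simp: distrib_left)
qed (auto simp: distrib_right)

lemma lin_partial_deriv:
  "lin \<phi> (partial_deriv i P) = lin (\<lambda>m. real (lookup m i) * \<phi> (m - single i 1)) P"
  by (induction P rule: poly_mapping_add_induct) auto

section \<open>Polynomials in \<open>n\<close> variables\<close>

lemma keys_diff_nat: "keys (m - m' :: monomial) \<subseteq> keys m"
  by (auto simp: in_keys_iff lookup_minus)

lemma polys_zero [intro, simp]: "0 \<in> polys n"
  by (simp add: polys_def)

lemma polys_add [intro]: "P \<in> polys n \<Longrightarrow> Q \<in> polys n \<Longrightarrow> P + Q \<in> polys n"
  using keys_add[of P Q] by (auto simp: polys_def)

lemma polys_sum [intro]: "(\<And>x. x \<in> A \<Longrightarrow> f x \<in> polys n) \<Longrightarrow> sum f A \<in> polys n"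
  by (induction A rule: infinite_finite_induct) auto

lemma polys_minus [intro]: "P \<in> polys n \<Longrightarrow> - P \<in> polys n"
  by (auto simp: polys_def in_keys_iff)

lemma polys_diff [intro]: "P \<in> polys n \<Longrightarrow> Q \<in> polys n \<Longrightarrow> P - Q \<in> polys n"
  using polys_add[of P n "- Q"] by auto

lemma polys_mult [intro]:
  assumes "P \<in> polys n" "Q \<in> polys n"
  shows "P * Q \<in> polys n"
proof -
  have "keys m \<subseteq> {1..n}" if m: "m \<in> keys (P * Q)" for m
  proof -
    obtain p q where "m = p + q" "p \<in> keys P" "q \<in> keys Q"
      using keys_mult[of P Q] m by blast
    then show ?thesis
      using assms keys_add[of p q] unfolding polys_def by blast
  qed
  then show ?thesis by (simp add: polys_def)
qed

lemma polys_Const [intro, simp]: "Const c \<in> polys n"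
  by (simp add: polys_def)

lemma polys_one [intro, simp]: "1 \<in> polys n"
  by (simp add: polys_def)

lemma polys_Var [intro]: "i \<in> {1..n} \<Longrightarrow> Var i \<in> polys n"
  by (simp add: Var_def polys_def)

lemma polys_power [intro]: "P \<in> polys n \<Longrightarrow> P ^ j \<in> polys n"
  by (induction j) auto

lemma polys_prod [intro]: "(\<And>x. x \<in> A \<Longrightarrow> f x \<in> polys n) \<Longrightarrow> prod f A \<in> polys n"
  by (induction A rule: infinite_finite_induct) auto

lemma polys_partial_deriv [intro]:
  assumes "P \<in> polys n"
  shows "partial_deriv i P \<in> polys n"
  unfolding partial_deriv_def
proof (rule polys_sum)
  fix m assume "m \<in> keys P"
  then have "keys m \<subseteq> {1..n}" using assms by (auto simp: polys_def)
  then have "keys (m - single i 1) \<subseteq> {1..n}" using keys_diff_nat by blast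
  then show "single (m - single i 1) (real (lookup m i) * lookup P m) \<in> polys n"
    by (simp add: polys_def)
qed

section \<open>Total degree\<close>

definition mdegree :: "monomial \<Rightarrow> nat" where
  "mdegree m = (\<Sum>i\<in>keys m. lookup m i)"

lemma mdegree_superset: "finite A \<Longrightarrow> keys m \<subseteq> A \<Longrightarrow> mdegree m = (\<Sum>i\<in>A. lookup m i)"
  unfolding mdegree_def by (intro sum.mono_neutral_left) (auto simp: in_keys_iff)

lemma mdegree_add: "mdegree (m + m') = mdegree m + mdegree m'"
proof -
  have "keys (m + m') \<subseteq> keys m \<union> keys m'" by (rule keys_add)
  then show ?thesis
    by (simp add: mdegree_superset[of "keys m \<union> keys m'"] lookup_add sum.distrib)
qed

lemma mdegree_simps [simp]: "mdegree 0 = 0" "mdegree (single i e) = e"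
  by (simp_all add: mdegree_def)

lemma total_degree_le_iff: "total_degree P \<le> d \<longleftrightarrow> (\<forall>m\<in>keys P. mdegree m \<le> d)"
  by (simp add: total_degree_def mdegree_def)

lemma total_degree_zero [simp]: "total_degree 0 = 0"
  by (simp add: total_degree_def)

lemma total_degree_add_le:
  assumes "total_degree P \<le> d" "total_degree Q \<le> d"
  shows "total_degree (P + Q) \<le> d"
  using assms keys_add[of P Q] by (auto simp: total_degree_le_iff)

lemma total_degree_sum_le:
  "(\<And>x. x \<in> A \<Longrightarrow> total_degree (f x) \<le> d) \<Longrightarrow> total_degree (sum f A) \<le> d"
  by (induction A rule: infinite_finite_induct) (auto intro: total_degree_add_le)

lemma total_degree_diff_le:
  assumes "total_degree P \<le> d" "total_degree Q \<le> d"
  shows "total_degree (P - Q) \<le> d"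
  using assms keys_diff[of P Q] total_degree_add_le[of P d "- Q"]
  by (auto simp: total_degree_le_iff in_keys_iff)

lemma total_degree_mult_le: "total_degree (P * Q) \<le> total_degree P + total_degree Q"
proof -
  have "mdegree m \<le> total_degree P + total_degree Q" if m: "m \<in> keys (P * Q)" for m
  proof -
    obtain p q where pq: "m = p + q" "p \<in> keys P" "q \<in> keys Q"
      using keys_mult[of P Q] m by blast
    then have "mdegree p \<le> total_degree P" "mdegree q \<le> total_degree Q"
      using total_degree_le_iff by blast+
    then show ?thesis using pq by (simp add: mdegree_add)
  qed
  then show ?thesis by (simp add: total_degree_le_iff)
qed

lemma total_degree_Const [simp]: "total_degree (Const c) = 0"
  using total_degree_le_iff[of "Const c" 0] by simp

lemma total_degree_one [simp]: "total_degree 1 = 0"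
  using total_degree_Const[of 1] by simp

lemma total_degree_numeral [simp]: "total_degree (numeral w) = 0"
  using total_degree_Const[of "numeral w"] by simp

lemma total_degree_Var_le: "total_degree (Var i) \<le> 1"
  by (simp add: Var_def total_degree_le_iff)

lemma total_degree_power_le: "total_degree (P ^ j) \<le> j * total_degree P"
  by (induction j) (auto intro: order.trans[OF total_degree_mult_le])

lemma total_degree_prod_le: "total_degree (prod f A) \<le> (\<Sum>x\<in>A. total_degree (f x))"
  by (induction A rule: infinite_finite_induct) (auto intro: order.trans[OF total_degree_mult_le])

section \<open>Zeroes of given multiplicity\<close>

lemma has_zero_of_mult_ge_0 [simp]: "has_zero_of_mult_ge n 0 P a"
  by (simp add: has_zero_of_mult_ge_def)

text \<open>\<open>foldr\<close> applies the last list entry first, so the derivative taken first is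
  split off at the end of the list. This recursion drives the inductions on multiplicity.\<close>

lemma has_zero_of_mult_ge_Suc:
  "has_zero_of_mult_ge n (Suc k) P a \<longleftrightarrow>
     eval_mpoly P a = 0 \<and> (\<forall>i\<in>{1..n}. has_zero_of_mult_ge n k (partial_deriv i P) a)"
  (is "?L \<longleftrightarrow> ?R")
proof
  assume L: ?L
  have "eval_mpoly (foldr partial_deriv is (partial_deriv i P)) a = 0"
    if "i \<in> {1..n}" "set is \<subseteq> {1..n}" "length is < k" for i "is"
    using L[unfolded has_zero_of_mult_ge_def, rule_format, of "is @ [i]"] that by simp
  moreover have "eval_mpoly P a = 0"
    using L[unfolded has_zero_of_mult_ge_def, rule_format, of "[]"] by simp
  ultimately show ?R by (simp add: has_zero_of_mult_ge_def)
next
  assume R: ?R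
  show ?L unfolding has_zero_of_mult_ge_def
  proof (intro allI impI)
    fix "is" assume h: "set is \<subseteq> {1..n} \<and> length is < Suc k"
    show "eval_mpoly (foldr partial_deriv is P) a = 0"
    proof (cases "is" rule: rev_cases)
      case Nil
      then show ?thesis using R by simp
    next
      case (snoc js j)
      then show ?thesis using R h by (auto simp: has_zero_of_mult_ge_def)
    qed
  qed
qed

lemma has_zero_of_mult_ge_mono:
  "has_zero_of_mult_ge n k P a \<Longrightarrow> j \<le> k \<Longrightarrow> has_zero_of_mult_ge n j P a"
  by (auto simp: has_zero_of_mult_ge_def)

lemma has_zero_of_mult_ge_zero [simp]: "has_zero_of_mult_ge n k 0 a"
  by (induction k) (auto simp: has_zero_of_mult_ge_Suc)

lemma has_zero_of_mult_ge_add: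
  "has_zero_of_mult_ge n k P a \<Longrightarrow> has_zero_of_mult_ge n k Q a \<Longrightarrow> has_zero_of_mult_ge n k (P + Q) a"
  by (induction k arbitrary: P Q) (auto simp: has_zero_of_mult_ge_Suc)

lemma has_zero_of_mult_ge_minus:
  "has_zero_of_mult_ge n k P a \<Longrightarrow> has_zero_of_mult_ge n k (- P) a"
  by (induction k arbitrary: P) (auto simp: has_zero_of_mult_ge_Suc)

lemma has_zero_of_mult_ge_sum:
  "(\<And>x. x \<in> A \<Longrightarrow> has_zero_of_mult_ge n k (f x) a) \<Longrightarrow> has_zero_of_mult_ge n k (sum f A) a"
  by (induction A rule: infinite_finite_induct) (auto intro: has_zero_of_mult_ge_add)

text \<open>By the Leibniz rule, differentiating takes one from \<open>k\<close> or from
  \<open>l\<close>, so induction on \<open>N = k + l\<close> applies to both summands. If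
  \<open>k\<close> is \<open>0\<close>, nothing can be taken from it, but then \<open>l\<close> has
  one to spare, and vice versa.\<close>

lemma has_zero_of_mult_ge_mult:
  assumes "has_zero_of_mult_ge n k P a" "has_zero_of_mult_ge n l Q a"
  shows "has_zero_of_mult_ge n (k + l) (P * Q) a"
proof -
  have "has_zero_of_mult_ge n N (P * Q) a"
    if "has_zero_of_mult_ge n k P a" "has_zero_of_mult_ge n l Q a" "k + l = N" for N k l P Q
    using that
  proof (induction N arbitrary: k l P Q)
    case (Suc N)
    have "eval_mpoly (P * Q) a = 0"
      using Suc.prems by (cases k; cases l) (auto simp: has_zero_of_mult_ge_Suc)
    moreover have "has_zero_of_mult_ge n N (partial_deriv i P * Q) a" if "i \<in> {1..n}" for i
    proof (cases k)
      case 0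
      then show ?thesis
        using Suc.IH[of 0 _ N] Suc.prems has_zero_of_mult_ge_mono[of n l Q a N] by auto
    next
      case (Suc k')
      then show ?thesis
        using Suc.IH[of k' "partial_deriv i P" l Q] Suc.prems that by (auto simp: has_zero_of_mult_ge_Suc)
    qed
    moreover have "has_zero_of_mult_ge n N (P * partial_deriv i Q) a" if "i \<in> {1..n}" for i
    proof (cases l)
      case 0
      then show ?thesis
        using Suc.IH[of N _ 0] Suc.prems has_zero_of_mult_ge_mono[of n k P a N] by auto
    next
      case (Suc l')
      then show ?thesis
        using Suc.IH[of k P l' "partial_deriv i Q"] Suc.prems that by (auto simp: has_zero_of_mult_ge_Suc)
    qed
    ultimately show ?case
      by (auto simp: has_zero_of_mult_ge_Suc intro!: has_zero_of_mult_ge_add)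
  qed simp
  then show ?thesis using assms by blast
qed

lemma has_zero_of_mult_ge_power:
  "eval_mpoly P a = 0 \<Longrightarrow> has_zero_of_mult_ge n j (P ^ j) a"
proof (induction j)
  case (Suc j)
  then show ?case
    using has_zero_of_mult_ge_mult[of n 1 P a j "P ^ j"] by (simp add: has_zero_of_mult_ge_Suc)
qed simp

lemma has_zero_of_mult_ge_prod:
  "(\<And>x. x \<in> A \<Longrightarrow> has_zero_of_mult_ge n (d x) (f x) a) \<Longrightarrow>
     has_zero_of_mult_ge n (\<Sum>x\<in>A. d x) (\<Prod>x\<in>A. f x) a"
  by (induction A rule: infinite_finite_induct) (auto intro: has_zero_of_mult_ge_mult)

subsection \<open>Residues and the lower bound\<close>

text \<open>
  Up to a common sign, \<open>res0 a j\<close> and \<open>res1 a j\<close> are the residues of \<open>x^j / (x (x - 1))^(a + 1)\<close> at \<open>0\<close>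
  and at \<open>1\<close>.
\<close>

definition res0 :: "nat \<Rightarrow> nat \<Rightarrow> real" where
  "res0 a j = (if j \<le> a then (real j - real a - 1) gchoose a else 0)"

definition res1 :: "nat \<Rightarrow> nat \<Rightarrow> real" where
  "res1 a j = - ((real j - real a - 1) gchoose a)"

text \<open>The residue at infinity vanishes, since the numerator degree \<open>j\<close> is at
  least two below the denominator degree \<open>2 * (a + 1)\<close>. For \<open>j > a\<close> the
  binomial has a natural number below \<open>a\<close> on top.\<close>

lemma res0_add_res1: "j \<le> 2 * a \<Longrightarrow> res0 a j + res1 a j = 0"
proof (cases "j \<le> a")
  case False
  moreover assume "j \<le> 2 * a"
  moreover have "real j - real a - 1 = real (j - a - 1)"
    using False by (simp add: of_nat_diff)
  moreover have "real (j - a - 1) gchoose a = real ((j - a - 1) choose a)"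
    by (rule binomial_gbinomial[symmetric])
  ultimately show ?thesis
    by (simp add: res0_def res1_def binomial_eq_0 del: of_nat_diff)
qed (simp add: res0_def res1_def)

lemma res0_expansion: "res0 a j = (\<Sum>r\<le>a. res0 a r * real (j choose r) * 0 ^ (j - r))"
proof -
  have "res0 a r * real (j choose r) * 0 ^ (j - r) = (if r = j then res0 a j else 0)" for r
    by (cases r j rule: linorder_cases) auto
  then show ?thesis by (simp add: res0_def[of a j])
qed

text \<open>The residue depends only on the Taylor coefficients of \<open>x^j\<close> at
  \<open>1\<close> of order at most \<open>a\<close>. The weights are, up to sign, Taylor
  coefficients of \<open>x^(-a-1)\<close>, and Vandermonde's identity multiplies the two
  series.\<close>

lemma res1_expansion:
  "res1 a j = (\<Sum>r\<le>a. - ((- real a - 1) gchoose (a - r)) * real (j choose r) * 1 ^ (j - r))"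
proof -
  have "real j - real a - 1 = real j + (- real a - 1)" by simp
  then have "res1 a j = - (\<Sum>r\<le>a. (real j gchoose r) * ((- real a - 1) gchoose (a - r)))"
    by (simp only: res1_def gbinomial_Vandermonde[symmetric] atLeast0AtMost)
  also have "\<dots> = (\<Sum>r\<le>a. - ((- real a - 1) gchoose (a - r)) * real (j choose r) * 1 ^ (j - r))"
    unfolding sum_negf[symmetric] by (intro sum.cong) (simp_all add: binomial_gbinomial)
  finally show ?thesis .
qed

text \<open>The matrix \<open>res0 s j\<close> is triangular with nonzero diagonal, so subtracting a
  multiple of \<open>res0 b\<close> clears entry \<open>b\<close>.\<close>

lemma res0_spanning:
  assumes "\<And>j. j \<ge> b \<Longrightarrow> f j = 0"
  shows "\<exists>c. \<forall>j. f j = (\<Sum>s<b. c s * res0 s j)"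
  using assms
proof (induction b arbitrary: f)
  case (Suc b)
  have nz: "res0 b b \<noteq> 0"
    using gbinomial_minus[of "1::real" b] by (simp add: res0_def binomial_gbinomial[symmetric])
  define d where "d = f b / res0 b b"
  have "f j - d * res0 b j = 0" if "j \<ge> b" for j
    using Suc.prems[of j] that nz by (cases "j = b") (auto simp: d_def res0_def)
  from Suc.IH[of "\<lambda>j. f j - d * res0 b j", OF this] obtain c where
    c: "\<And>j. f j - d * res0 b j = (\<Sum>s<b. c s * res0 s j)" by blast
  have "f j = (\<Sum>s<Suc b. (c(b := d)) s * res0 s j)" for j
    using c[of j] by simp
  then show ?case by blast
qed auto

text \<open>The left side is the residue of \<open>x * x^j\<close>, and near \<open>0\<close>
  \<open>x\<close> is a power series in \<open>y = x (x - 1)\<close> without constant term, so only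
  indices below \<open>b\<close> occur. \<open>c 0\<close> is its coefficient of \<open>y^b\<close>,
  a Catalan number up to sign.\<close>

lemma res0_shift:
  assumes "b > 0"
  obtains c where "c 0 \<noteq> 0" "\<And>j. res0 b (Suc j) = (\<Sum>s<b. c s * res0 s j)"
proof -
  obtain c where c: "\<And>j. res0 b (Suc j) = (\<Sum>s<b. c s * res0 s j)"
    using res0_spanning[of b "\<lambda>j. res0 b (Suc j)"] by (auto simp: res0_def)
  \<comment> \<open>\<open>c 0\<close> is isolated by evaluating at \<open>2 x - 1\<close>, the derivative of \<open>x (x - 1)\<close>.\<close>
  have test: "2 * res0 s 1 - res0 s 0 = (if s = 0 then - 1 else 0)" for s
  proof (cases "s = 0")
    case False
    then show ?thesis
      using gbinomial_absorb_comp[of "- real s" s] by (simp add: res0_def field_simps)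
  qed (simp add: res0_def)
  have "2 * res0 b 2 - res0 b 1 = (\<Sum>s<b. c s * (2 * res0 s 1 - res0 s 0))"
    using c[of 0] c[of 1] by (simp add: numeral_2_eq_2 sum_distrib_left sum_subtractf algebra_simps)
  also have "\<dots> = - c 0"
    using assms unfolding test by (simp add: if_distrib cong: if_cong)
  finally have c0: "2 * res0 b 2 - res0 b 1 = - c 0" .
  have f0: "res0 b 1 = (- real b) gchoose b"
    using assms by (simp add: res0_def)
  have "real b + real b - 1 = real (2 * b - 1)" using assms by (simp add: of_nat_diff)
  then have nz: "res0 b 1 \<noteq> 0"
    using gbinomial_minus[of "real b" b] assms unfolding f0
    by (simp add: binomial_gbinomial[symmetric] del: of_nat_diff)
  \<comment> \<open>For \<open>b = 1\<close> the exponent \<open>2\<close> exceeds \<open>b\<close>,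
    and both sides are \<open>0\<close>.\<close>
  have f1: "res0 b 2 = (1 - real b) gchoose b"
    using assms by (cases "b = 1") (auto simp: res0_def)
  \<comment> \<open>Together with \<open>c0\<close> this yields
    \<open>(2 * b - 1) * c 0 = res0 b 1\<close>.\<close>
  have "(1 - 2 * real b) * res0 b 2 = (1 - real b) * res0 b 1"
    using gbinomial_absorb_comp[of "1 - real b" b] unfolding f0 f1 by (simp add: algebra_simps)
  then have "(1 - 2 * real b) * (2 * res0 b 2 - res0 b 1) = res0 b 1"
    by (simp add: algebra_simps)
  then have "c 0 \<noteq> 0" using nz c0 by auto
  with c show ?thesis using that by blast
qed

text \<open>The \<open>r\<close>-th derivative of \<open>x^j\<close> at \<open>z\<close>, keeping
  the factorial that a Hasse derivative divides out, so that it matches iterated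
  \<open>partial_deriv\<close>. For \<open>j < r\<close> the binomial is \<open>0\<close>, which
  makes the truncated exponent harmless.\<close>

definition hasse :: "nat \<Rightarrow> real \<Rightarrow> nat \<Rightarrow> real" where
  "hasse r z j = fact r * real (j choose r) * z ^ (j - r)"

lemma hasse_Suc: "hasse (Suc r) z j = real j * hasse r z (j - 1)"
proof -
  have "real (Suc r) * real (j choose Suc r) = real j * real ((j - 1) choose r)"
    using binomial_absorption[of r j] by (metis of_nat_mult)
  then have "fact r * z ^ (j - Suc r) * (real (Suc r) * real (j choose Suc r)) =
      fact r * z ^ (j - Suc r) * (real j * real ((j - 1) choose r))"
    by (rule arg_cong)
  then show ?thesis by (simp add: hasse_def mult_ac)
qed

lemma eval_mpoly_polys:
  assumes "P \<in> polys n"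
  shows "eval_mpoly P a = lin (\<lambda>m. \<Prod>i\<in>{1..n}. a i ^ lookup m i) P"
  unfolding eval_mpoly_lin
  using assms by (intro lin_cong prod_keys_superset) (auto simp: polys_def)

lemma sum_fun_upd:
  fixes f :: "'a \<Rightarrow> 'b::comm_monoid_add"
  assumes "finite A" "i \<in> A"
  shows "sum (f(i := x)) A = x + sum f (A - {i})"
proof -
  have "sum (f(i := x)) (A - {i}) = sum f (A - {i})"
    by (intro sum.cong) auto
  then show ?thesis using assms by (simp add: sum.remove)
qed

text \<open>The functional is the value at \<open>a\<close> of the mixed partial derivative of
  \<open>P\<close> with \<open>\<rho> i\<close> differentiations in \<open>x_i\<close>. The
  induction moves one derivative at a time from the functional onto \<open>P\<close>.\<close>

lemma lin_hasse_eq_0: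
  assumes "P \<in> polys n" "has_zero_of_mult_ge n k P a" "sum \<rho> {1..n} < k"
  shows "lin (\<lambda>m. \<Prod>i\<in>{1..n}. hasse (\<rho> i) (a i) (lookup m i)) P = 0"
  using assms
proof (induction "sum \<rho> {1..n}" arbitrary: \<rho> k P)
  case 0
  then have "eval_mpoly P a = 0"
    by (cases k) (auto simp: has_zero_of_mult_ge_Suc)
  then show ?case
    using 0 by (simp add: eval_mpoly_polys hasse_def)
next
  case (Suc N)
  obtain k' where k: "k = Suc k'" using Suc.prems by (cases k) auto
  have "\<exists>i\<in>{1..n}. \<rho> i > 0"
    using Suc.hyps(2) by (metis gr_zeroI sum.neutral nat.distinct(1))
  then obtain i where i: "i \<in> {1..n}" "\<rho> i > 0" by blast
  define \<rho>' where "\<rho>' = \<rho>(i := \<rho> i - 1)"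
  have s: "sum \<rho> {1..n} = \<rho> i + sum \<rho> ({1..n} - {i})"
    "sum \<rho>' {1..n} = \<rho>' i + sum \<rho> ({1..n} - {i})"
    using i sum_fun_upd[of "{1..n}" i \<rho> "\<rho> i - 1"] sum.remove[of "{1..n}" i \<rho>]
    by (simp_all add: \<rho>'_def)
  have "lin (\<lambda>m. \<Prod>j\<in>{1..n}. hasse (\<rho>' j) (a j) (lookup m j)) (partial_deriv i P) = 0"
    using Suc.prems Suc.hyps(2) s i k
    by (intro Suc.hyps(1)[of _ _ k']) (auto simp: \<rho>'_def has_zero_of_mult_ge_Suc)
  moreover have "(\<Prod>j\<in>{1..n}. hasse (\<rho> j) (a j) (lookup m j)) =
      real (lookup m i) * (\<Prod>j\<in>{1..n}. hasse (\<rho>' j) (a j) (lookup (m - single i 1) j))" for m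
  proof -
    have "hasse (\<rho> i) (a i) (lookup m i) =
        real (lookup m i) * hasse (\<rho>' i) (a i) (lookup (m - single i 1) i)"
      using hasse_Suc[of "\<rho> i - 1" "a i" "lookup m i"] i by (simp add: \<rho>'_def lookup_minus)
    moreover have "(\<Prod>j\<in>{1..n} - {i}. hasse (\<rho> j) (a j) (lookup m j)) =
        (\<Prod>j\<in>{1..n} - {i}. hasse (\<rho>' j) (a j) (lookup (m - single i 1) j))"
      by (intro prod.cong) (auto simp: \<rho>'_def lookup_minus lookup_single)
    ultimately show ?thesis
      unfolding prod.remove[OF finite_atLeastAtMost i(1)] by (simp only: mult.assoc)
  qed
  ultimately show ?case by (simp add: lin_partial_deriv)
qed

section \<open>Iterated residues at the origin\<close>

definition Res :: "nat \<Rightarrow> (nat \<Rightarrow> nat) \<Rightarrow> real_mpoly \<Rightarrow> real" where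
  "Res n \<beta> P = lin (\<lambda>m. \<Prod>i\<in>{1..n}. res0 (\<beta> i) (lookup m i)) P"

lemma finite_cube [simp]: "finite (cube n)"
  by (simp add: cube_def finite_PiE)

lemma origin_in_cube [simp]: "origin n \<in> cube n"
  by (auto simp: origin_def cube_def)

text \<open>The residues at all points of the cube sum to \<open>0\<close> when the degree is small.
  Away from the origin each is a combination of derivatives of order at most
  \<open>sum \<beta> {1..n}\<close>, which the multiplicity kills.\<close>

lemma Res_eq_0:
  assumes P: "P \<in> polys n" and deg: "total_degree P < n + 2 * sum \<beta> {1..n}"
    and mult: "\<And>a. a \<in> cube n - {origin n} \<Longrightarrow> has_zero_of_mult_ge n k P a"
    and k: "sum \<beta> {1..n} < k"
  shows "Res n \<beta> P = 0"
proof -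
  define res where "res b z = (if z = (0::real) then res0 b else res1 b)" for b z
  \<comment> \<open>Weights of the Taylor coefficients in the two expansions; dividing by
    \<open>fact r\<close> below cancels the factorial in \<open>hasse\<close>.\<close>
  define w where "w b z r = (if z = (0::real) then res0 b r
    else - ((- real b - 1) gchoose (b - r)))" for b z r
  have res_w: "res b z j = (\<Sum>r\<le>b. w b z r / fact r * hasse r z j)" if "z \<in> {0, 1}" for b z j
    using that res0_expansion[of b j] res1_expansion[of b j]
    by (auto simp: res_def w_def hasse_def mult.assoc)
  have "(\<Prod>i\<in>{1..n}. \<Sum>z\<in>{0,1}. res (\<beta> i) z (lookup m i)) = 0" if "m \<in> keys P" for m
  proof -
    \<comment> \<open>Otherwise each exponent is at least \<open>2 * \<beta> i + 1\<close>, and the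
      degree of \<open>m\<close> reaches \<open>n + 2 * sum \<beta> {1..n}\<close>.\<close>
    have "\<exists>i\<in>{1..n}. lookup m i \<le> 2 * \<beta> i"
    proof (rule ccontr)
      assume large: "\<not> ?thesis"
      have "n + 2 * sum \<beta> {1..n} = (\<Sum>i\<in>{1..n}. 2 * \<beta> i + 1)"
        by (simp only: sum.distrib sum_distrib_left) simp
      also have "\<dots> \<le> (\<Sum>i\<in>{1..n}. lookup m i)"
        using large by (intro sum_mono) (auto simp: not_le Suc_le_eq)
      also have "\<dots> = mdegree m"
        using P that by (intro mdegree_superset[symmetric]) (auto simp: polys_def)
      also have "\<dots> \<le> total_degree P"
        using that total_degree_le_iff by blast
      finally show False using deg by simp
    qed
    then obtain i where i: "i \<in> {1..n}" "lookup m i \<le> 2 * \<beta> i" by blast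
    then have "(\<Sum>z\<in>{0,1}. res (\<beta> i) z (lookup m i)) = 0"
      using res0_add_res1 by (simp add: res_def)
    then show ?thesis using i by (meson finite_atLeastAtMost prod_zero)
  qed
  then have "0 = lin (\<lambda>m. \<Prod>i\<in>{1..n}. \<Sum>z\<in>{0,1}. res (\<beta> i) z (lookup m i)) P"
    unfolding lin_def by (intro sum.neutral[symmetric] ballI) (simp only: mult_zero_right)
  also have "\<dots> = lin (\<lambda>m. \<Sum>a\<in>cube n. \<Prod>i\<in>{1..n}. res (\<beta> i) (a i) (lookup m i)) P"
    unfolding cube_def by (subst prod_sum_PiE) auto
  also have "\<dots> = (\<Sum>a\<in>cube n. lin (\<lambda>m. \<Prod>i\<in>{1..n}. res (\<beta> i) (a i) (lookup m i)) P)"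
    by (rule lin_fun_sum)
  also have "\<dots> = lin (\<lambda>m. \<Prod>i\<in>{1..n}. res (\<beta> i) (origin n i) (lookup m i)) P"
  proof -
    have "lin (\<lambda>m. \<Prod>i\<in>{1..n}. res (\<beta> i) (a i) (lookup m i)) P = 0" if a: "a \<in> cube n - {origin n}" for a
    proof -
      have "(\<Prod>i\<in>{1..n}. res (\<beta> i) (a i) (lookup m i)) =
          (\<Sum>\<rho>\<in>Pi\<^sub>E {1..n} (\<lambda>i. {..\<beta> i}). (\<Prod>i\<in>{1..n}. w (\<beta> i) (a i) (\<rho> i) / fact (\<rho> i)) *
            (\<Prod>i\<in>{1..n}. hasse (\<rho> i) (a i) (lookup m i)))" for m
      proof -
        have "(\<Prod>i\<in>{1..n}. res (\<beta> i) (a i) (lookup m i)) =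
            (\<Prod>i\<in>{1..n}. \<Sum>r\<in>{..\<beta> i}. w (\<beta> i) (a i) r / fact r * hasse r (a i) (lookup m i))"
          using a by (intro prod.cong refl res_w) (auto simp: cube_def)
        then show ?thesis
          unfolding prod.distrib[symmetric] by (simp add: prod_sum_PiE)
      qed
      moreover have "lin (\<lambda>m. \<Prod>i\<in>{1..n}. hasse (\<rho> i) (a i) (lookup m i)) P = 0"
        if "\<rho> \<in> Pi\<^sub>E {1..n} (\<lambda>i. {..\<beta> i})" for \<rho>
      proof (rule lin_hasse_eq_0[OF P mult[OF a]])
        have "sum \<rho> {1..n} \<le> sum \<beta> {1..n}"
          using that by (intro sum_mono) auto
        then show "sum \<rho> {1..n} < k" using k by simp
      qed
      ultimately show ?thesis by (simp add: lin_fun_sum lin_fun_scale)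
    qed
    then show ?thesis
      by (subst sum.remove[of _ "origin n"]) auto
  qed
  also have "\<dots> = Res n \<beta> P"
    unfolding Res_def by (intro lin_cong prod.cong) (auto simp: res_def origin_def)
  finally show ?thesis by simp
qed

lemma Res_split:
  assumes "i \<in> {1..n}"
  shows "Res n \<beta> P = lin (\<lambda>m. (\<Prod>j\<in>{1..n} - {i}. res0 (\<beta> j) (lookup m j)) * res0 (\<beta> i) (lookup m i)) P"
  unfolding Res_def using assms
  by (intro lin_cong) (subst prod.remove[of _ i], auto)

text \<open>Only the exponent of \<open>x_i\<close> is shifted, so the one-variable relation applies
  in that coordinate.\<close>

lemma Res_Var_mult:
  assumes i: "i \<in> {1..n}" and c: "\<And>j. res0 b (Suc j) = (\<Sum>s<b. c s * res0 s j)"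
  shows "Res n (\<beta>(i := b)) (Var i * P) = (\<Sum>s<b. c s * Res n (\<beta>(i := s)) P)"
proof -
  let ?R = "\<lambda>m. \<Prod>j\<in>{1..n} - {i}. res0 (\<beta> j) (lookup m j)"
  have R: "(\<Prod>j\<in>{1..n} - {i}. res0 ((\<beta>(i := s)) j) (lookup m j)) = ?R m" for m s
    by (intro prod.cong) auto
  have "?R (single i 1 + m) = ?R m" for m
    by (intro prod.cong) (auto simp: lookup_add lookup_single)
  then have "Res n (\<beta>(i := b)) (Var i * P) = lin (\<lambda>m. ?R m * res0 b (Suc (lookup m i))) P"
    unfolding Var_def Res_split[OF i] R lin_mult_single by (simp add: lookup_add)
  also have "\<dots> = lin (\<lambda>m. \<Sum>s<b. c s * (?R m * res0 s (lookup m i))) P"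
    unfolding c by (simp add: sum_distrib_left mult.left_commute)
  also have "\<dots> = (\<Sum>s<b. c s * Res n (\<beta>(i := s)) P)"
    unfolding Res_split[OF i] R by (simp add: lin_fun_sum lin_fun_scale)
  finally show ?thesis .
qed

lemma Res_eq_0_descent:
  assumes N: "N \<le> n"
    and P: "\<And>\<alpha>. sum \<alpha> {1..n} = N \<Longrightarrow> Res n \<alpha> P = 0"
    and XP: "\<And>\<alpha> i. i \<in> {1..n} \<Longrightarrow> sum \<alpha> {1..n} = N \<Longrightarrow> Res n \<alpha> (Var i * P) = 0"
    and "sum \<beta> {1..n} \<le> N"
  shows "Res n \<beta> P = 0"
  using assms(4)
proof (induction "N - sum \<beta> {1..n}" arbitrary: \<beta> rule: less_induct)
  case less
  define b where "b = N - sum \<beta> {1..n}"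
  show ?case
  proof (cases "b = 0")
    case True
    then show ?thesis using P less.prems by (simp add: b_def)
  next
    case False
    \<comment> \<open>If all entries were positive, their sum would be at least
      \<open>n \<ge> N\<close>, but it is less than \<open>N\<close>.\<close>
    have "\<exists>i\<in>{1..n}. \<beta> i = 0"
    proof (rule ccontr)
      assume "\<not> ?thesis"
      then have "(\<Sum>i\<in>{1..n}. 1) \<le> sum \<beta> {1..n}"
        by (intro sum_mono) (auto simp: Suc_le_eq)
      then show False using False N by (simp add: b_def)
    qed
    then obtain i where i: "i \<in> {1..n}" "\<beta> i = 0" by blast
    have s: "sum (\<beta>(i := s)) {1..n} = sum \<beta> {1..n} + s" for s
      using sum_fun_upd[of "{1..n}" i \<beta> s] sum.remove[of "{1..n}" i \<beta>] i by simp
    obtain c where c: "c 0 \<noteq> 0" "\<And>j. res0 b (Suc j) = (\<Sum>s<b. c s * res0 s j)"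
      using res0_shift False by blast
    \<comment> \<open>The entry \<open>b\<close> at \<open>i\<close> raises the sum to
      \<open>N\<close>. In the expansion, indices with \<open>0 < s < b\<close> have a larger sum
      than \<open>\<beta>\<close> and fall under the induction hypothesis; only the term with
      \<open>c 0\<close> remains.\<close>
    have "0 = Res n (\<beta>(i := b)) (Var i * P)"
      using XP[OF i(1)] s[of b] less.prems by (simp add: b_def)
    also have "\<dots> = (\<Sum>s<b. c s * Res n (\<beta>(i := s)) P)"
      by (rule Res_Var_mult[OF i(1) c(2)])
    also have "\<dots> = (\<Sum>s<b. if s = 0 then c 0 * Res n \<beta> P else 0)"
    proof (intro sum.cong refl)
      fix t assume t: "t \<in> {..<b}"
      show "c t * Res n (\<beta>(i := t)) P = (if t = 0 then c 0 * Res n \<beta> P else 0)"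
      proof (cases "t = 0")
        case True
        then have "\<beta>(i := t) = \<beta>" using i by auto
        then show ?thesis using True by simp
      next
        case False
        then have "Res n (\<beta>(i := t)) P = 0"
          using t s[of t] by (intro less.hyps) (auto simp: b_def)
        then show ?thesis using False by simp
      qed
    qed
    also have "\<dots> = c 0 * Res n \<beta> P" using False by simp
    finally show ?thesis using c by simp
  qed
qed

lemma total_degree_lower_bound:
  assumes k: "k \<ge> 2" "n \<ge> k - 1" and P: "P \<in> polys n" "eval_mpoly P (origin n) \<noteq> 0"
    and mult: "\<And>a. a \<in> cube n - {origin n} \<Longrightarrow> has_zero_of_mult_ge n k P a"
  shows "total_degree P \<ge> n + 2 * k - 3"
proof (rule ccontr)
  assume deg: "\<not> ?thesis"
  have "Res n (\<lambda>_. 0) P = 0"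
  proof (rule Res_eq_0_descent[OF k(2)])
    fix \<alpha> assume a: "sum \<alpha> {1..n} = k - 1"
    show "Res n \<alpha> P = 0"
      using a deg k by (intro Res_eq_0[of _ _ _ k] P mult) auto
    fix i assume i: "i \<in> {1..n}"
    \<comment> \<open>For index sum \<open>k - 1\<close>, \<open>Res_eq_0\<close> admits degrees
      below \<open>n + 2 * k - 2\<close>, which leaves room for the extra factor
      \<open>Var i\<close>.\<close>
    have "total_degree (Var i * P) \<le> 1 + total_degree P"
      using total_degree_mult_le[of "Var i" P] total_degree_Var_le[of i] by linarith
    moreover have "has_zero_of_mult_ge n k (Var i * P) a" if "a \<in> cube n - {origin n}" for a
      using has_zero_of_mult_ge_mult[of n 0 "Var i" a k P] mult[OF that] by simp
    ultimately show "Res n \<alpha> (Var i * P) = 0"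
      using a deg k i P by (intro Res_eq_0[of _ _ _ k] polys_mult polys_Var) auto
  qed auto
  \<comment> \<open>\<open>res0 0\<close> is \<open>1\<close> at exponent \<open>0\<close> and
    \<open>0\<close> elsewhere, so this residue reads off the constant term.\<close>
  moreover have "Res n (\<lambda>_. 0) P = eval_mpoly P (origin n)"
    unfolding Res_def eval_mpoly_polys[OF P(1)]
    by (intro lin_cong prod.cong) (auto simp: res0_def origin_def)
  ultimately show False using P by simp
qed

subsection \<open>A polynomial of minimal degree\<close>

definition poly_at :: "real poly \<Rightarrow> real_mpoly \<Rightarrow> real_mpoly" where
  "poly_at p x = poly (map_poly Const p) x"

lemma poly_at_pCons [simp]: "poly_at (pCons c p) x = Const c + x * poly_at p x"
  by (simp add: poly_at_def map_poly_pCons)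

lemma poly_at_0 [simp]: "poly_at 0 x = 0"
  by (simp add: poly_at_def)

lemma poly_at_add [simp]: "poly_at (p + q) x = poly_at p x + poly_at q x"
proof (induction p arbitrary: q)
  case (pCons c p)
  then show ?case by (cases q) (simp add: single_add algebra_simps)
qed simp

lemma poly_at_smult [simp]: "poly_at (smult c p) x = Const c * poly_at p x"
  by (induction p) (auto simp: mult_single algebra_simps)

lemma poly_at_mult [simp]: "poly_at (p * q) x = poly_at p x * poly_at q x"
  by (induction p) (auto simp: algebra_simps)

lemma poly_at_1 [simp]: "poly_at 1 x = 1"
  by (simp add: one_pCons)

lemma poly_at_power [simp]: "poly_at (p ^ j) x = poly_at p x ^ j"
  by (induction j) auto

lemma poly_at_sum [simp]: "poly_at (sum f A) x = (\<Sum>y\<in>A. poly_at (f y) x)"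
  by (induction A rule: infinite_finite_induct) auto

text \<open>Near \<open>x = 1\<close>, \<open>2 x - 1\<close> is the square root of
  \<open>1 + 4 y\<close> with \<open>y = x (x - 1)\<close>, so truncating the series of that root
  leaves an error divisible by \<open>(x - 1)^k\<close>. The induction finds the coefficients one by
  one.\<close>

lemma power_dvd_truncated_sqrt:
  assumes "k > 0"
  shows "\<exists>c r. c 0 = 1 \<and>
    (\<Sum>j<k. smult (c j) ([:0, -1, 1:] ^ j)) + [:1, -2:] = [:-1, 1:] ^ k * (r :: real poly)"
  using assms
proof (induction k rule: nat_induct_non_zero)
  case 1
  have "(\<Sum>j<1. smult ((\<lambda>_. 1) j) ([:0, -1, 1:] ^ j)) + [:1, -2:] = [:-1, 1:] ^ 1 * ([:-2:] :: real poly)"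
    by simp
  then show ?case by (intro exI[of _ "\<lambda>_. 1"] exI[of _ "[:-2:]"]) simp
next
  case (Suc k)
  then obtain c r where c: "c 0 = 1" and
    r: "(\<Sum>j<k. smult (c j) ([:0, -1, 1:] ^ j)) + [:1, -2:] = [:-1, 1:] ^ k * (r :: real poly)"
    by blast
  \<comment> \<open>Here \<open>y^k = (x - 1)^k x^k\<close>, and \<open>x^k\<close> is
    \<open>1\<close> at \<open>x = 1\<close>; this coefficient makes the new cofactor vanish there,
    giving one more factor \<open>x - 1\<close>.\<close>
  define d where "d = - poly r 1"
  have "poly (smult d ([:0, 1:] ^ k) + r) 1 = 0"
    by (simp add: d_def)
  then obtain r' where r': "smult d ([:0, 1:] ^ k) + r = [:-1, 1:] * r'"
    unfolding poly_eq_0_iff_dvd by (auto elim: dvdE)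
  have y: "[:0, -1, 1:] = [:-1, 1:] * ([:0, 1:] :: real poly)" by simp
  have "(\<Sum>j<Suc k. smult ((c(k := d)) j) ([:0, -1, 1:] ^ j)) + [:1, -2:] =
      smult d ([:0, -1, 1:] ^ k) + [:-1, 1:] ^ k * r"
    using r by simp
  also have "\<dots> = [:-1, 1:] ^ k * (smult d ([:0, 1:] ^ k) + r)"
    unfolding y power_mult_distrib by (simp add: algebra_simps)
  also have "\<dots> = [:-1, 1:] ^ Suc k * r'"
    unfolding r' by (simp only: mult_ac power_Suc)
  finally have "(\<Sum>j<Suc k. smult ((c(k := d)) j) ([:0, -1, 1:] ^ j)) + [:1, -2:] =
      [:-1, 1:] ^ Suc k * r'" .
  moreover have "(c(k := d)) 0 = 1" using c Suc.hyps by simp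
  ultimately show ?case by blast
qed

abbreviation y_var :: "nat \<Rightarrow> real_mpoly" where
  "y_var i \<equiv> Var i * Var i - Var i"

lemma minimal_degree_construction:
  assumes k: "k \<ge> 2"
  obtains P where "P \<in> polys n" "eval_mpoly P (origin n) \<noteq> 0"
    "\<And>a. a \<in> cube n - {origin n} \<Longrightarrow> has_zero_of_mult_ge n k P a"
    "total_degree P \<le> n + 2 * k - 3"
proof -
  obtain c r where c: "c 0 = 1" and
    r: "(\<Sum>j<k. smult (c j) ([:0, -1, 1:] ^ j)) + [:1, -2:] = [:-1, 1:] ^ k * (r :: real poly)"
    using power_dvd_truncated_sqrt[of k] k by auto
  \<comment> \<open>\<open>j = 0\<close> selects \<open>1 - 2 x_i\<close>, and \<open>Suc j\<close> the term of degree \<open>j\<close> in \<open>y_i\<close>.\<close>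
  define g where "g i j = (case j of 0 \<Rightarrow> 1 - 2 * Var i | Suc j \<Rightarrow> Const (c j) * y_var i ^ j)" for i j
  \<comment> \<open>Each \<open>f\<close> in \<open>F\<close> picks one term from every factor of
    \<open>W\<close>, and \<open>wt f\<close> is its total degree in the \<open>y_i\<close>:
    truncated subtraction yields \<open>0\<close> both for \<open>1 - 2 * Var i\<close> and for the
    constant \<open>c 0\<close>.\<close>
  define F where "F = Pi\<^sub>E {1..n} (\<lambda>_. {..k})"
  define wt :: "(nat \<Rightarrow> nat) \<Rightarrow> nat" where "wt f = (\<Sum>i\<in>{1..n}. f i - 1)" for f
  define G where "G f = (\<Prod>i\<in>{1..n}. g i (f i))" for f
  define W where "W = (\<Prod>i\<in>{1..n}. \<Sum>j\<le>k. g i j)"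
  define P where "P = (\<Sum>f\<in>{f\<in>F. wt f < k}. G f)"
  have finF: "finite F" by (simp add: F_def finite_PiE)
  have factor: "(\<Sum>j\<le>k. g i j) = (\<Sum>j<k. Const (c j) * y_var i ^ j) + (1 - 2 * Var i)" for i
  proof -
    have "(\<Sum>j\<le>k. g i j) = g i 0 + (\<Sum>j<k. g i (Suc j))"
      by (simp add: lessThan_Suc_atMost[symmetric] sum.lessThan_Suc_shift del: sum.lessThan_Suc)
    then show ?thesis by (simp add: g_def)
  qed
  have factor': "(\<Sum>j\<le>k. g i j) = (Var i - 1) ^ k * poly_at r (Var i)" for i
  proof -
    have "(\<Sum>j\<le>k. g i j) = poly_at ((\<Sum>j<k. smult (c j) ([:0, -1, 1:] ^ j)) + [:1, -2:]) (Var i)"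
      unfolding factor by (simp add: single_uminus algebra_simps)
    also have "\<dots> = (Var i - 1) ^ k * poly_at r (Var i)"
      unfolding r by (simp add: single_uminus)
    finally show ?thesis .
  qed
  have WP: "P = W - (\<Sum>f\<in>{f\<in>F. wt f \<ge> k}. G f)"
  proof -
    have "W = (\<Sum>f\<in>F. G f)"
      unfolding W_def G_def F_def by (rule prod_sum_PiE) auto
    also have "F = {f\<in>F. wt f < k} \<union> {f\<in>F. wt f \<ge> k}" by auto
    also have "(\<Sum>f\<in>\<dots>. G f) = P + (\<Sum>f\<in>{f\<in>F. wt f \<ge> k}. G f)"
      unfolding P_def using finF by (intro sum.union_disjoint) auto
    finally show ?thesis by simp
  qed
  \<comment> \<open>Each \<open>y_var i\<close> vanishes at both \<open>0\<close> and
    \<open>1\<close>, so the multiplicities of the factors add up to at least \<open>wt f\<close> at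
    every point of the cube.\<close>
  have high: "has_zero_of_mult_ge n k (G f) a" if "wt f \<ge> k" "a \<in> cube n" for f a
  proof -
    have "has_zero_of_mult_ge n (f i - 1) (g i (f i)) a" if "i \<in> {1..n}" for i
    proof (cases "f i")
      case (Suc j)
      have "a i \<in> {0, 1}" using \<open>a \<in> cube n\<close> that by (auto simp: cube_def)
      then have "has_zero_of_mult_ge n j (y_var i ^ j) a"
        by (intro has_zero_of_mult_ge_power) auto
      then show ?thesis
        using has_zero_of_mult_ge_mult[of n 0 "Const (c j)" a j "y_var i ^ j"] Suc by (simp add: g_def)
    qed simp
    then have "has_zero_of_mult_ge n (wt f) (G f) a"
      unfolding wt_def G_def by (intro has_zero_of_mult_ge_prod) auto
    then show ?thesis using that has_zero_of_mult_ge_mono by blast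
  qed
  have g_polys: "g i j \<in> polys n" if "i \<in> {1..n}" for i j
  proof -
    have "2 * Var i \<in> polys n"
      using polys_mult[OF polys_Const[of 2] polys_Var[OF that]] by simp
    then show ?thesis
      using that unfolding g_def by (cases j) (auto intro!: polys_diff polys_mult polys_power polys_Var)
  qed
  have deg_g: "total_degree (g i j) \<le> (if j = 0 then 1 else 2 * (j - 1))" for i j
  proof (cases j)
    case 0
    have "total_degree (2 * Var i) \<le> 1"
      using total_degree_mult_le[of "Const 2" "Var i"] total_degree_Var_le[of i] by simp
    then show ?thesis using 0 by (auto simp: g_def intro: total_degree_diff_le)
  next
    case (Suc j')
    have "total_degree (Var i * Var i) \<le> 2"
      using total_degree_mult_le[of "Var i" "Var i"] total_degree_Var_le[of i] by linarith
    then have "total_degree (y_var i) \<le> 2"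
      using total_degree_Var_le[of i] by (intro total_degree_diff_le) auto
    then have "j' * total_degree (y_var i) \<le> 2 * j'" by simp
    then have "total_degree (y_var i ^ j') \<le> 2 * j'"
      using total_degree_power_le[of "y_var i" j'] by linarith
    then show ?thesis
      using Suc total_degree_mult_le[of "Const (c j')" "y_var i ^ j'"] by (simp add: g_def)
  qed
  have deg_G: "total_degree (G f) \<le> n + 2 * k - 3" if "wt f < k" for f
  proof -
    have 1: "total_degree (G f) \<le> (\<Sum>i\<in>{1..n}. if f i = 0 then 1 else 2 * (f i - 1))"
      unfolding G_def by (rule order.trans[OF total_degree_prod_le sum_mono[OF deg_g]])
    show ?thesis
    proof (cases "\<forall>i\<in>{1..n}. f i = 0")
      case True
      then have "(\<Sum>i\<in>{1..n}. if f i = 0 then 1 else 2 * (f i - 1)) = n" by simp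
      then show ?thesis using 1 k by linarith
    next
      case False
      \<comment> \<open>At most \<open>n - 1\<close> factors are then \<open>1 - 2 * Var i\<close>,
        which bounds the degree by \<open>n - 1 + 2 * (k - 1)\<close>.\<close>
      then obtain i where i: "i \<in> {1..n}" "f i \<noteq> 0" by blast
      have "(\<Sum>i\<in>{1..n}. if f i = 0 then 1 else 2 * (f i - 1)) =
          (\<Sum>j\<in>{1..n}. 2 * (f j - 1)) + (\<Sum>j\<in>{1..n}. if f j = 0 then 1 else 0)"
        unfolding sum.distrib[symmetric] by (intro sum.cong) auto
      also have "(\<Sum>j\<in>{1..n}. 2 * (f j - 1)) = 2 * wt f"
        by (simp add: wt_def sum_distrib_left)
      also have "(\<Sum>j\<in>{1..n}. if f j = 0 then 1 else 0) =
          (\<Sum>j\<in>{1..n} - {i}. if f j = 0 then 1 else 0)"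
        using i by (simp only: sum.remove[OF finite_atLeastAtMost i(1)]) simp
      also have "\<dots> \<le> (\<Sum>j\<in>{1..n} - {i}. 1::nat)"
        by (intro sum_mono) simp
      also have "\<dots> = n - 1" using i by simp
      finally show ?thesis using 1 that k i by simp
    qed
  qed
  show ?thesis
  proof
    show "P \<in> polys n"
      unfolding P_def G_def by (intro polys_sum polys_prod g_polys)
    show "total_degree P \<le> n + 2 * k - 3"
      unfolding P_def using deg_G by (intro total_degree_sum_le) auto
    have "eval_mpoly (G f) (origin n) = 0" if "wt f \<ge> k" for f
      using has_zero_of_mult_ge_mono[OF high[OF that origin_in_cube], of 1] k
      by (simp add: has_zero_of_mult_ge_Suc)
    then have "eval_mpoly P (origin n) = (\<Prod>i\<in>{1..n}. \<Sum>j\<le>k. eval_mpoly (g i j) (origin n))"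
      unfolding WP W_def by simp
    \<comment> \<open>At the origin all \<open>y_i\<close> vanish, so each factor equals
      \<open>c 0 + 1\<close>.\<close>
    also have "\<dots> = (\<Prod>i\<in>{1..n}. 2)"
    proof (intro prod.cong refl)
      fix i assume "i \<in> {1..n}"
      then have o: "origin n i = 0" by (simp add: origin_def)
      have "(\<Sum>j\<le>k. eval_mpoly (g i j) (origin n)) = eval_mpoly (\<Sum>j\<le>k. g i j) (origin n)"
        by simp
      also have "\<dots> = (\<Sum>j<k. if j = 0 then 1 else 0) + 1"
        unfolding factor using o c by (auto simp: power_0_left if_distrib cong: if_cong)
      also have "\<dots> = 2" using k by simp
      finally show "(\<Sum>j\<le>k. eval_mpoly (g i j) (origin n)) = 2" .
    qed
    finally show "eval_mpoly P (origin n) \<noteq> 0" by simp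
    fix a assume a: "a \<in> cube n - {origin n}"
    have "\<exists>i\<in>{1..n}. a i \<noteq> 0"
    proof (rule ccontr)
      assume "\<not> ?thesis"
      then have "a = origin n"
        using a by (intro PiE_ext[of a "{1..n}" "\<lambda>_. {0, 1}" "origin n"])
          (auto simp: cube_def origin_def)
      then show False using a by simp
    qed
    \<comment> \<open>By \<open>factor'\<close>, the factor of \<open>W\<close> with this index
      alone supplies multiplicity \<open>k\<close> at \<open>a\<close>.\<close>
    then obtain i where i: "i \<in> {1..n}" "a i = 1"
      using a by (auto simp: cube_def PiE_iff)
    have "has_zero_of_mult_ge n k ((Var i - 1) ^ k) a"
      using i by (intro has_zero_of_mult_ge_power) simp
    then have "has_zero_of_mult_ge n (k + 0) ((Var i - 1) ^ k *
        (poly_at r (Var i) * (\<Prod>i\<in>{1..n} - {i}. \<Sum>j\<le>k. g i j))) a"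
      by (intro has_zero_of_mult_ge_mult) auto
    moreover have "W = (Var i - 1) ^ k * (poly_at r (Var i) * (\<Prod>i\<in>{1..n} - {i}. \<Sum>j\<le>k. g i j))"
      unfolding W_def using i factor'[of i] by (subst prod.remove[of _ i]) (auto simp: mult.assoc)
    ultimately have "has_zero_of_mult_ge n k W a" by simp
    moreover have "has_zero_of_mult_ge n k (\<Sum>f\<in>{f\<in>F. wt f \<ge> k}. G f) a"
      using high a by (intro has_zero_of_mult_ge_sum) auto
    ultimately show "has_zero_of_mult_ge n k P a"
      unfolding WP using has_zero_of_mult_ge_add has_zero_of_mult_ge_minus
      by (metis diff_conv_add_uminus)
  qed
qed

theorem theorem1p3:
  fixes k n :: nat
  assumes "k \<ge> 2" and "n \<ge> 2 * k - 3"
  shows "(\<forall>P \<in> polys n. eval_mpoly P (origin n) \<noteq> 0 \<and>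
            (\<forall>a \<in> cube n - {origin n}. has_zero_of_mult_ge n k P a) \<longrightarrow>
            total_degree P \<ge> n + 2 * k - 3) \<and>
         (\<exists>P \<in> polys n. eval_mpoly P (origin n) \<noteq> 0 \<and>
            (\<forall>a \<in> cube n - {origin n}. has_zero_of_mult_ge n k P a) \<and>
            total_degree P = n + 2 * k - 3)"
proof -
  have n: "n \<ge> k - 1" using assms by linarith
  obtain P where P: "P \<in> polys n" "eval_mpoly P (origin n) \<noteq> 0"
    "\<And>a. a \<in> cube n - {origin n} \<Longrightarrow> has_zero_of_mult_ge n k P a"
    "total_degree P \<le> n + 2 * k - 3"
    using minimal_degree_construction[OF assms(1)] by blast
  have "total_degree P = n + 2 * k - 3"
    using total_degree_lower_bound[OF assms(1) n P(1-3)] P(4) by simp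
  then show ?thesis
    using total_degree_lower_bound[OF assms(1) n] P(1-3) by blast
qed

end
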